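(* Let $G$ be a finite cyclic group of prime order $n$. Let $G_0\subseteq G$ and $d\in\Delta^{\ast}(G)\cap\mathbb N_{\ge(2n^2)^{1/3}}$. Then $\min\Delta(G_0)=d$ if and only if \[\{f,\tfrac{n-c_1}{c_2}f\}\subseteq G_0\subseteq\{0,f,\tfrac{n-c_1}{c_2}f\}\] for some positive integers $c_1,c_2$ with $d=\frac{n-c_1-c_2}{c_1c_2}$ and some $f\in G\setminus\{0\}$.
   Context: $\mathbb N_{\ge a}=\{k\in\mathbb N:k\ge a\}$. For $G_0\subseteq G$: $\mathcal B(G_0)$ is the monoid of zero-sum sequences over $G_0$, whose atoms are the minimal zero-sum sequences; $\mathsf L(B)$ is the set of lengths of factorizations of $B$ into minimal zero-sum sequences; for $L=\{\ell_1<\dots<\ell_k\}$, $\Delta(L)=\{\ell_{i+1}-\ell_i\}$; $\Delta(G_0)=\bigcup_B\Delta(\mathsf L(B))$; $\min\Delta(G_0)$ is its minimum with $\min\emptyset=0$. $\Delta^{\ast}(G)=\{\min\Delta(G_0):G_0\subseteq G,\ \Delta(G_0)\ne\emptyset\}$. *)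

theory Defs
  imports Complex_Main "HOL-Library.Multiset" "HOL-Computational_Algebra.Primes"
begin

text \<open>
  Abelian groups are written additively and are types of class \<open>ab_group_add\<close>.
  A sequence over a set \<open>G\<^sub>0\<close> (a formal product of group elements, order being disregarded)
  is a finite multiset; the monoid operation on sequences is multiset union.
\<close>

definition nmult :: "nat \<Rightarrow> 'a::comm_monoid_add \<Rightarrow> 'a" where
  "nmult k g = (\<Sum>i<k. g)"

definition zero_sum_monoid :: "'a::ab_group_add set \<Rightarrow> 'a multiset set" where
  "zero_sum_monoid G\<^sub>0 = {S. set_mset S \<subseteq> G\<^sub>0 \<and> sum_mset S = 0}"

definition minimal_zero_sum :: "'a::ab_group_add multiset \<Rightarrow> bool" where
  "minimal_zero_sum U \<longleftrightarrow>
     U \<noteq> {#} \<and> sum_mset U = 0 \<and> (\<forall>V. V \<subset># U \<and> V \<noteq> {#} \<longrightarrow> sum_mset V \<noteq> 0)"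

text \<open>
  A factorization of \<open>B\<close> is a multiset \<open>F\<close> of minimal zero-sum sequences with product \<open>B\<close>.
  If \<open>B\<close> is a sequence over \<open>G\<^sub>0\<close>, then so are all members of \<open>F\<close>, hence
  the set of lengths does not depend on \<open>G\<^sub>0\<close>.
\<close>

definition lengths :: "'a::ab_group_add multiset \<Rightarrow> nat set" where
  "lengths B = {size F | F. (\<forall>U \<in># F. minimal_zero_sum U) \<and> \<Sum>\<^sub># F = B}"

definition distances :: "nat set \<Rightarrow> nat set" where
  "distances L = {l' - l | l l'. l \<in> L \<and> l' \<in> L \<and> l < l' \<and> (\<forall>m \<in> L. \<not> (l < m \<and> m < l'))}"

definition Delta :: "'a::ab_group_add set \<Rightarrow> nat set" where
  "Delta G\<^sub>0 = (\<Union>B \<in> zero_sum_monoid G\<^sub>0. distances (lengths B))"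

definition min_Delta :: "'a::ab_group_add set \<Rightarrow> nat" where
  "min_Delta G\<^sub>0 = (if Delta G\<^sub>0 = {} then 0 else LEAST d. d \<in> Delta G\<^sub>0)"

definition Delta_star :: "'a::ab_group_add set \<Rightarrow> nat set" where
  "Delta_star G = {min_Delta G\<^sub>0 | G\<^sub>0. G\<^sub>0 \<subseteq> G \<and> Delta G\<^sub>0 \<noteq> {}}"

end

theory Submission imports Defs begin

text \<open>
  Since \<open>n\<close> is prime, \<open>U\<^sup>n\<close> is both a product of \<open>n\<close> copies of \<open>U\<close> and of the \<open>|U|\<close> atoms \<open>g\<^sup>n\<close>,
  \<open>g \<in> U\<close>; hence \<open>|U| \<equiv> n\<close> modulo \<open>d = min \<Delta>(G\<^sub>0)\<close> for every atom \<open>U\<close> over \<open>G\<^sub>0 - {0}\<close>.  Let \<open>f\<close> and \<open>g = a f\<close>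
  be distinct nonzero elements of \<open>G\<^sub>0\<close>, and let \<open>n = q a + r\<close> be the division with remainder.  The
  atom \<open>g f\<^bsup>n - a\<^esup>\<close> yields \<open>d | a - 1\<close>, and the first atom of the form \<open>f\<^sup>x g\<^sup>y\<close> with \<open>x < r\<close>, \<open>y > q\<close> yields
  \<open>a = 1 + d i r\<close> for some \<open>i\<close>, so that \<open>n = q + r + d i q r\<close> and \<open>q g = - r f\<close> with \<open>d q r < n\<close>.
  Three nonzero elements give three such relations; eliminating two of the elements produces a
  multiple \<open>m f = 0\<close> with \<open>0 < m < 2 (n / d)\<^sup>3 \<le> n\<close>, which is impossible.  For two elements, giving \<open>f\<close> the
  weight \<open>1\<close> and \<open>g\<close> the weight \<open>a\<close>, every atom has weight congruent to \<open>n\<close> modulo \<open>d i n\<close>, which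
  shows \<open>min \<Delta>({f, g}) = d i\<close>.
\<close>

section \<open>Lengths and distances\<close>

text \<open>The successor of \<open>l\<close> in \<open>L\<close> supplies the distance, and it lies
  no further away than \<open>l'\<close>.\<close>

lemma distances_gap:
  assumes "l \<in> L" "l' \<in> L" "l < l'"
  obtains e where "e \<in> distances L" "0 < e" "e \<le> l' - l"
proof -
  define m where "m = (LEAST m. m \<in> L \<and> l < m)"
  have m: "m \<in> L \<and> l < m"
    unfolding m_def by (rule LeastI[of _ l']) (use assms in simp)
  have least: "m \<le> k" if "k \<in> L" "l < k" for k
    unfolding m_def by (rule Least_le) (use that in simp)
  have "m - l \<in> distances L"
    using m assms least unfolding distances_def by (fastforce simp: not_less)
  then show thesis
    using that m least[of l'] assms by force
qed

lemma lengths_add: "l \<in> lengths B \<Longrightarrow> m \<in> lengths C \<Longrightarrow> l + m \<in> lengths (B + C)"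
  unfolding lengths_def by (fastforce intro: exI[of _ "_ + _"])

lemma lengths_repeat: "l \<in> lengths B \<Longrightarrow> k * l \<in> lengths (repeat_mset k B)"
proof (induction k)
  case 0
  show ?case by (auto simp: lengths_def intro!: exI[of _ "{#}"])
next
  case (Suc k)
  then show ?case using lengths_add[of l B "k * l"] by simp
qed

lemma lengths_atom: "minimal_zero_sum U \<Longrightarrow> 1 \<in> lengths U"
  unfolding lengths_def by (auto intro!: exI[of _ "{#U#}"])

lemma zero_sum_monoid_add:
  "B \<in> zero_sum_monoid G \<Longrightarrow> C \<in> zero_sum_monoid G \<Longrightarrow> B + C \<in> zero_sum_monoid G"
  unfolding zero_sum_monoid_def by auto

lemma zero_sum_monoid_repeat:
  "B \<in> zero_sum_monoid G \<Longrightarrow> repeat_mset k B \<in> zero_sum_monoid G"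
proof (induction k)
  case 0
  show ?case by (simp add: zero_sum_monoid_def)
next
  case (Suc k)
  then show ?case using zero_sum_monoid_add[of B G "repeat_mset k B"] by simp
qed

lemma min_Delta_le: "e \<in> Delta G \<Longrightarrow> min_Delta G \<le> e"
  unfolding min_Delta_def by (auto intro: Least_le)

lemma min_Delta_in: "Delta G \<noteq> {} \<Longrightarrow> min_Delta G \<in> Delta G"
  unfolding min_Delta_def by (auto intro: LeastI)

text \<open>If \<open>\<Delta>(G)\<close> is empty, then \<open>min_Delta G = 0\<close>, and the claim says that lengths are unique.\<close>

lemma min_Delta_dvd:
  assumes B: "B \<in> zero_sum_monoid G" and "l \<in> lengths B" "l' \<in> lengths B" "l \<le> l'"
  shows "min_Delta G dvd l' - l"
proof (cases "l = l'")
  case True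
  then show ?thesis by simp
next
  case False
  define d where "d = min_Delta G"
  obtain e where "e \<in> distances (lengths B)"
    using distances_gap[OF assms(2,3)] False assms(4) by auto
  then have "Delta G \<noteq> {}" using B unfolding Delta_def by auto
  then have "d \<in> Delta G" using min_Delta_in d_def by auto
  then obtain C x y where C: "C \<in> zero_sum_monoid G"
    and xy: "x \<in> lengths C" "y \<in> lengths C" "x < y" "d = y - x"
    unfolding Delta_def distances_def by auto
  define q r where "q = (l' - l) div d" and "r = (l' - l) mod d"
  have eq: "l' = l + q * d + r" using assms(4) unfolding q_def r_def by simp
  have y: "y = x + d" and "d > 0" using xy by auto
  have "r = 0"
  proof (rule ccontr)
    assume "r \<noteq> 0"
    \<comment> \<open>\<open>C\<close> has the lengths \<open>x\<close> and \<open>x + d\<close>.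
      Multiplying \<open>B\<close> by \<open>q\<close> copies of \<open>C\<close> produces two
      lengths that differ by the remainder \<open>r\<close> alone, which would force a distance
      below \<open>d\<close>.\<close>
    let ?E = "repeat_mset q C + B"
    have E: "?E \<in> zero_sum_monoid G"
      by (intro zero_sum_monoid_add zero_sum_monoid_repeat B C)
    have "q * y + l \<in> lengths ?E" "q * x + l' \<in> lengths ?E"
      by (intro lengths_add lengths_repeat xy assms)+
    moreover have "q * x + l' = q * y + l + r" using eq y by (simp add: algebra_simps)
    ultimately obtain e where e: "e \<in> distances (lengths ?E)" "e \<le> r"
      using distances_gap[of "q * y + l" "lengths ?E" "q * x + l'"] \<open>r \<noteq> 0\<close> by auto
    then have "e \<in> Delta G" using E unfolding Delta_def by blast
    then have "d \<le> r" using min_Delta_le e d_def by fastforce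
    then show False using \<open>d > 0\<close> unfolding r_def
      by (meson mod_less_divisor not_less)
  qed
  then show ?thesis unfolding r_def d_def by auto
qed

corollary min_Delta_dvd_int:
  assumes "B \<in> zero_sum_monoid G" and "l \<in> lengths B" "l' \<in> lengths B"
  shows "int (min_Delta G) dvd int l - int l'"
proof (cases "l \<le> l'")
  case True
  then show ?thesis
    using min_Delta_dvd[OF assms True] by (metis dvd_diff_commute int_dvd_int_iff of_nat_diff)
next
  case False
  then show ?thesis
    using min_Delta_dvd[OF assms(1,3,2)] by (metis int_dvd_int_iff nle_le of_nat_diff)
qed

text \<open>Weights add up, so a factorization of length \<open>l\<close> gives \<open>C\<close> the
  weight \<open>l * n\<close> modulo \<open>d * n\<close>; comparing two lengths and cancelling
  \<open>n\<close> leaves a congruence modulo \<open>d\<close>. For \<open>d = 0\<close> the lengths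
  coincide.\<close>

lemma lengths_cong_weight:
  fixes w :: "'a::ab_group_add \<Rightarrow> nat"
  assumes "n > 0"
    and w: "\<And>U. minimal_zero_sum U \<Longrightarrow> set_mset U \<subseteq> G \<Longrightarrow>
              int (d * n) dvd int (\<Sum>x\<in>#U. w x) - int n"
    and C: "C \<in> zero_sum_monoid G" "l \<in> lengths C" "l' \<in> lengths C"
  shows "int d dvd int l - int l'"
proof -
  have wF: "int (d * n) dvd int (\<Sum>x\<in>#\<Sum>\<^sub># F. w x) - int n * int (size F)"
    if "\<forall>U\<in>#F. minimal_zero_sum U" "set_mset (\<Sum>\<^sub># F) \<subseteq> G" for F
    using that
  proof (induction F)
    case empty
    show ?case by simp
  next
    case (add U F)
    then have "int (d * n) dvd (int (\<Sum>x\<in>#U. w x) - int n) +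
        (int (\<Sum>x\<in>#\<Sum>\<^sub># F. w x) - int n * int (size F))"
      by (intro dvd_add w) auto
    then show ?case by (simp add: algebra_simps)
  qed
  have *: "int (d * n) dvd int (\<Sum>x\<in>#C. w x) - int n * int l" if "l \<in> lengths C" for l
    using that C(1) wF unfolding lengths_def zero_sum_monoid_def by auto
  from dvd_diff[OF *[OF C(3)] *[OF C(2)]] have "int n * int d dvd int n * (int l - int l')"
    by (simp add: algebra_simps)
  then show ?thesis using \<open>n > 0\<close> by simp
qed

text \<open>The weight congruence bounds every distance below by \<open>d\<close>; the two lengths
  of \<open>B\<close> enclose a distance of at most \<open>d\<close>.\<close>

lemma min_Delta_eqI:
  fixes w :: "'a::ab_group_add \<Rightarrow> nat"
  assumes "n > 0"
    and "\<And>U. minimal_zero_sum U \<Longrightarrow> set_mset U \<subseteq> G \<Longrightarrow>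
              int (d * n) dvd int (\<Sum>x\<in>#U. w x) - int n"
    and B: "B \<in> zero_sum_monoid G" "l \<in> lengths B" "l + d \<in> lengths B" "d > 0"
  shows "min_Delta G = d"
proof -
  note dvd = lengths_cong_weight[of n G d w, OF assms(1,2)]
  have ge: "d \<le> e" if e: "e \<in> Delta G" for e
  proof -
    obtain C l l' where "C \<in> zero_sum_monoid G" "l \<in> lengths C" "l' \<in> lengths C"
      "l < l'" "e = l' - l"
      using e unfolding Delta_def distances_def by auto
    with dvd[of C l' l] show ?thesis by (auto dest!: zdvd_imp_le)
  qed
  obtain e where e: "e \<in> distances (lengths B)" "e \<le> l + d - l"
    by (rule distances_gap[OF B(2,3)]) (use B in auto)
  then have "e \<in> Delta G" using B unfolding Delta_def by blast
  with ge[of e] e have "d \<in> Delta G" by auto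
  with ge show ?thesis using min_Delta_in[of G] min_Delta_le[of d G] by fastforce
qed

section \<open>Groups of prime order\<close>

lemma nmult_0 [simp]: "nmult 0 g = 0"
  by (simp add: nmult_def)

lemma nmult_Suc [simp]: "nmult (Suc k) g = g + nmult k g"
  by (simp add: nmult_def add.commute)

lemma nmult_zero_right [simp]: "nmult k 0 = 0"
  by (induction k) auto

lemma sum_const_nmult: "finite A \<Longrightarrow> (\<Sum>x\<in>A. g) = nmult (card A) g"
  by (induction A rule: finite_induct) auto

lemma nmult_add: "nmult (j + k) g = nmult j g + nmult k g"
  by (induction j) (auto simp: add_ac)

lemma nmult_add_right: "nmult k (g + h) = nmult k g + nmult k h"
  by (induction k) (auto simp: add_ac)

lemma nmult_nmult: "nmult j (nmult k g) = nmult (j * k) g"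
  by (induction j) (auto simp: nmult_add)

lemma sum_mset_replicate: "sum_mset (replicate_mset k g) = nmult k g"
  by (induction k) auto

locale prime_order_group =
  fixes n :: nat and ty :: "'a::{ab_group_add,finite} itself"
  assumes prime: "prime n" and card: "card (UNIV :: 'a set) = n"
begin

lemma n_gt_1: "n > 1"
  using prime prime_gt_1_nat by blast

text \<open>Translation by \<open>f\<close> permutes the group, so the sum of all elements absorbs
  \<open>n\<close> copies of \<open>f\<close>.\<close>

lemma nmult_card [simp]: "nmult n (f::'a) = 0"
proof -
  have "(\<Sum>x\<in>UNIV. x) = (\<Sum>x\<in>UNIV. x + f)"
    by (rule sum.reindex_bij_betw[symmetric]) (simp add: bij_plus_right)
  also have "\<dots> = (\<Sum>x\<in>UNIV. x) + nmult n f"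
    by (simp add: sum.distrib sum_const_nmult card)
  finally show ?thesis by simp
qed

lemma nmult_eq_0_iff:
  assumes "(f::'a) \<noteq> 0"
  shows "nmult k f = 0 \<longleftrightarrow> n dvd k"
proof
  assume "n dvd k"
  then obtain j where "k = j * n" by (metis dvd_def mult.commute)
  then show "nmult k f = 0" by (simp flip: nmult_nmult)
next
  assume k: "nmult k f = 0"
  show "n dvd k"
  proof (rule ccontr)
    assume "\<not> n dvd k"
    then have "coprime k n" using prime prime_imp_coprime coprime_commute by blast
    moreover have "k \<noteq> 0" using \<open>\<not> n dvd k\<close> by (auto intro: ccontr)
    ultimately obtain x y where "k * x = n * y + 1"
      using bezout_nat[of k n] by auto
    then have "nmult (x * k) f = nmult (y * n + 1) f" by (simp add: mult.commute)
    then show False using assms k by (simp add: nmult_add flip: nmult_nmult)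
  qed
qed

lemma nmult_inj: "(f::'a) \<noteq> 0 \<Longrightarrow> inj_on (\<lambda>k. nmult k f) {..<n}"
proof (rule linorder_inj_onI')
  fix i j assume "f \<noteq> 0" "i \<in> {..<n}" "j \<in> {..<n}" "i < j"
  moreover have "nmult j f = nmult i f + nmult (j - i) f"
    using \<open>i < j\<close> by (simp flip: nmult_add)
  ultimately show "nmult i f \<noteq> nmult j f"
    using nmult_eq_0_iff[of f "j - i"] by (auto dest: dvd_imp_le)
qed

lemma obtain_nmult:
  assumes "(f::'a) \<noteq> 0"
  obtains k where "k < n" "g = nmult k f"
proof -
  have "card ((\<lambda>k. nmult k f) ` {..<n}) = card (UNIV :: 'a set)"
    using card_image[OF nmult_inj[OF assms]] card by simp
  then have "(\<lambda>k. nmult k f) ` {..<n} = UNIV"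
    by (intro card_subset_eq) auto
  then show thesis using that by blast
qed

lemma minimal_zero_sum_replicate:
  assumes "(g::'a) \<noteq> 0"
  shows "minimal_zero_sum (replicate_mset n g)"
  unfolding minimal_zero_sum_def
proof (intro conjI allI impI)
  fix V assume "V \<subset># replicate_mset n g \<and> V \<noteq> {#}"
  then obtain m where "V = replicate_mset m g" "m < n" "m > 0"
    by (metis mset_subset_size msubseteq_replicate_msetE size_replicate_mset subset_mset.less_imp_le
        bot_nat_0.not_eq_extremum replicate_mset_0)
  then show "sum_mset V \<noteq> 0"
    using nmult_eq_0_iff[OF assms] by (auto simp: sum_mset_replicate dest: dvd_imp_le)
qed (use n_gt_1 in \<open>auto simp: sum_mset_replicate\<close>)

lemma min_Delta_dvd_atom:
  assumes "minimal_zero_sum (U::'a multiset)" "set_mset U \<subseteq> G" "0 \<notin># U"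
  shows "int (min_Delta G) dvd int (size U) - int n"
proof (rule min_Delta_dvd_int)
  show "repeat_mset n U \<in> zero_sum_monoid G"
    using assms by (intro zero_sum_monoid_repeat) (auto simp: zero_sum_monoid_def minimal_zero_sum_def)
  \<comment> \<open>Collecting equal elements: for \<open>V = U\<close> the atoms
    \<open>replicate_mset n g\<close> form a factorization of length \<open>size U\<close>.\<close>
  have "\<Sum>\<^sub># (image_mset (replicate_mset n) V) = repeat_mset n V" for V :: "'a multiset"
  proof (induction V)
    case (add x V)
    then show ?case by (intro multiset_eqI) simp
  qed simp
  moreover have "\<forall>V\<in>#image_mset (replicate_mset n) U. minimal_zero_sum V"
  proof
    fix V assume "V \<in># image_mset (replicate_mset n) U"
    then obtain g where "g \<in># U" "V = replicate_mset n g" by auto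
    then show "minimal_zero_sum V" using assms(3) minimal_zero_sum_replicate by metis
  qed
  ultimately show "size U \<in> lengths (repeat_mset n U)"
    unfolding lengths_def by (intro CollectI exI[of _ "image_mset (replicate_mset n) U"]) simp
  show "n \<in> lengths (repeat_mset n U)"
    using lengths_repeat[OF lengths_atom[OF assms(1)], of n] by simp
qed

end

section \<open>Atoms over two elements\<close>

definition pair_seq :: "'a \<Rightarrow> 'a \<Rightarrow> nat \<Rightarrow> nat \<Rightarrow> 'a multiset" where
  "pair_seq f g x y = replicate_mset x f + replicate_mset y g"

lemma pair_seq_supportE:
  assumes "set_mset U \<subseteq> {f, g}" "f \<noteq> g"
  obtains x y where "U = pair_seq f g x y"
proof -
  have "U = pair_seq f g (count U f) (count U g)"
    using assms by (intro multiset_eqI) (auto simp: pair_seq_def not_in_iff)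
  then show thesis by (rule that)
qed

lemma pair_seq_subset_iff:
  assumes "f \<noteq> g"
  shows "pair_seq f g x y \<subseteq># pair_seq f g x' y' \<longleftrightarrow> x \<le> x' \<and> y \<le> y'"
  using assms by (auto simp: pair_seq_def subseteq_mset_def dest: spec[of _ f] spec[of _ g])

lemma pair_seq_eq_iff:
  assumes "f \<noteq> g"
  shows "pair_seq f g x y = pair_seq f g x' y' \<longleftrightarrow> x = x' \<and> y = y'"
  using assms pair_seq_subset_iff[OF assms] by (metis order_antisym subset_mset.order_refl)

lemma pair_seq_empty_iff: "pair_seq f g x y = {#} \<longleftrightarrow> x = 0 \<and> y = 0"
  by (simp add: pair_seq_def)

lemma set_pair_seq: "set_mset (pair_seq f g x y) \<subseteq> {f, g}"
  by (auto simp: pair_seq_def split: if_splits)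

lemma minimal_zero_sum_subset:
  assumes "minimal_zero_sum U" "V \<subseteq># U" "V \<noteq> {#}" "sum_mset V = 0"
  shows "V = U"
  using assms unfolding minimal_zero_sum_def by (auto simp: subset_mset.le_less)

text \<open>\<open>a\<close> is the logarithm of \<open>g\<close> to the base \<open>f\<close>;
  excluding 0 and 1 keeps \<open>g\<close> nonzero and distinct from \<open>f\<close>. It is also
  the weight of \<open>g\<close> when \<open>f\<close> has weight 1.\<close>

locale prime_order_pair = prime_order_group n ty
  for n :: nat and ty :: "'a::{ab_group_add,finite} itself" +
  fixes f g :: 'a and a :: nat
  assumes f_nz: "f \<noteq> 0" and g_eq: "g = nmult a f" and a_gt: "1 < a" and a_lt: "a < n"
begin

lemma g_nz: "g \<noteq> 0"
  using nmult_eq_0_iff[OF f_nz, of a] a_gt a_lt g_eq by (auto dest: dvd_imp_le)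

lemma f_neq_g: "f \<noteq> g"
  using inj_onD[OF nmult_inj[OF f_nz], of 1 a] a_gt a_lt g_eq by auto

lemma sum_pair_seq: "sum_mset (pair_seq f g x y) = nmult (x + y * a) f"
  by (simp add: pair_seq_def sum_mset_replicate g_eq nmult_nmult nmult_add)

lemma sum_pair_seq_eq_0_iff: "sum_mset (pair_seq f g x y) = 0 \<longleftrightarrow> n dvd x + y * a"
  by (simp add: sum_pair_seq nmult_eq_0_iff[OF f_nz])

text \<open>Since \<open>a\<close> is positive, a proper subsequence has strictly smaller weight
  \<open>x + y * a\<close>; so having the least weight among the nonempty zero-sum subsequences
  implies minimality.\<close>

lemma minimal_pair_seqI:
  assumes "x > 0 \<or> y > 0" "n dvd x + y * a"
    and "\<And>x' y'. x' \<le> x \<Longrightarrow> y' \<le> y \<Longrightarrow> x' > 0 \<or> y' > 0 \<Longrightarrow> n dvd x' + y' * a \<Longrightarrow>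
      x + y * a \<le> x' + y' * a"
  shows "minimal_zero_sum (pair_seq f g x y)"
  unfolding minimal_zero_sum_def
proof (intro conjI allI impI notI)
  fix V assume V: "V \<subset># pair_seq f g x y \<and> V \<noteq> {#}" "sum_mset V = 0"
  then have "set_mset V \<subseteq> {f, g}"
    using set_pair_seq[of f g x y] by (meson order_trans set_mset_mono subset_mset.less_imp_le)
  then obtain x' y' where xy: "V = pair_seq f g x' y'"
    using f_neq_g by (rule pair_seq_supportE)
  then have le: "x' \<le> x" "y' \<le> y"
    using V pair_seq_subset_iff[OF f_neq_g] by (meson subset_mset.less_imp_le)+
  have "x + y * a \<le> x' + y' * a"
    by (rule assms(3)) (use V xy le in \<open>auto simp: sum_pair_seq_eq_0_iff pair_seq_empty_iff\<close>)
  moreover have "y' * a \<le> y * a" using le by simp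
  ultimately have "x' = x" "y' * a = y * a" using le by linarith+
  then have "V = pair_seq f g x y" using xy a_gt by simp
  then show False using V by simp
qed (use assms in \<open>auto simp: pair_seq_empty_iff sum_pair_seq_eq_0_iff\<close>)

text \<open>Zero-sum sequences have weight divisible by \<open>n\<close>, so no nonempty one weighs
  less than \<open>n\<close>.\<close>

lemma minimal_pair_seq_weight_n:
  assumes "x + y * a = n"
  shows "minimal_zero_sum (pair_seq f g x y)"
proof (rule minimal_pair_seqI)
  fix x' y' assume "x' > 0 \<or> y' > 0" "n dvd x' + y' * a"
  then show "x + y * a \<le> x' + y' * a" using assms a_gt by (auto intro: dvd_imp_le)
qed (use assms n_gt_1 in \<open>auto intro: gr0I\<close>)

text \<open>
  Every nonempty zero-sum sequence \<open>f\<^sup>x g\<^sup>y\<close> with \<open>x < r\<close> has weight \<open>x + a y \<ge> j n\<close>, with equality here.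
\<close>

lemma minimal_pair_seq_record:
  assumes n: "n = q * a + r" and r: "r < a" and j: "0 < j" "(j - 1) * r < a" "a \<le> j * r"
  shows "minimal_zero_sum (pair_seq f g (j * r - a) (j * q + 1))"
proof (rule minimal_pair_seqI)
  \<comment> \<open>In \<open>j * n = j * q * a + j * r\<close>, one further \<open>a\<close> moves
    from \<open>j * r\<close> to the multiplicity of \<open>g\<close>.\<close>
  have weight: "j * r - a + (j * q + 1) * a = j * n"
    using n j by (simp add: algebra_simps)
  then show "n dvd j * r - a + (j * q + 1) * a" by simp
  fix x' y' assume le: "x' \<le> j * r - a" and nz: "x' > 0 \<or> y' > 0" and "n dvd x' + y' * a"
  then obtain k where k: "x' + y' * a = n * k" by (auto simp: dvd_def)
  have "k > 0" using k nz a_gt by (auto intro: gr0I)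
  have "j * r = (j - 1) * r + r" using j by (cases j) auto
  then have x': "x' < r" using le j by linarith
  \<comment> \<open>For \<open>k < j\<close>, the multiple
    \<open>a * (y' - k * q) = k * r - x'\<close> of \<open>a\<close> would lie strictly between 0
    and \<open>a\<close>.\<close>
  have "j \<le> k"
  proof (rule ccontr)
    assume "\<not> j \<le> k"
    then have "k * r \<le> (j - 1) * r" by (intro mult_right_mono) auto
    then have "k * r < a" using j by linarith
    moreover have "r \<le> k * r" using \<open>k > 0\<close> by simp
    moreover have eq: "int a * (int y' - int k * int q) = int (k * r) - int x'"
      using arg_cong[OF k, of int] n by (simp add: algebra_simps)
    ultimately have "0 < int a * (int y' - int k * int q)" "int a * (int y' - int k * int q) < int a * 1"
      using x' by linarith+
    then show False using a_gt by (auto simp: zero_less_mult_iff mult_less_cancel_left)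
  qed
  then show "j * r - a + (j * q + 1) * a \<le> x' + y' * a"
    unfolding weight k by (simp add: mult.commute)
qed auto

end

section \<open>The minimal distance of two elements\<close>

text \<open>With \<open>a = 1 + d * c\<^sub>1\<close>, the numbers \<open>c\<^sub>2\<close> and
  \<open>c\<^sub>1\<close> are quotient and remainder of \<open>n\<close> by \<open>a\<close>.
  Weights bound the distances below; a product with lengths 2 and \<open>d + 2\<close> bounds the
  minimum above.\<close>

lemma min_Delta_pair:
  fixes f :: "'a::{ab_group_add,finite}"
  assumes "prime n" "card (UNIV :: 'a set) = n" "f \<noteq> 0" "d > 0" "c\<^sub>1 > 0" "c\<^sub>2 > 0"
    and n: "n = c\<^sub>1 + c\<^sub>2 + d * c\<^sub>1 * c\<^sub>2"
    and G: "{f, nmult (1 + d * c\<^sub>1) f} \<subseteq> G" "G \<subseteq> {0, f, nmult (1 + d * c\<^sub>1) f}"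
  shows "min_Delta G = d"
proof -
  define a g where "a = 1 + d * c\<^sub>1" and "g = nmult a f"
  have na: "n = c\<^sub>2 * a + c\<^sub>1" unfolding n a_def by (simp add: algebra_simps)
  have "a \<le> c\<^sub>2 * a" using \<open>c\<^sub>2 > 0\<close> by simp
  then have "a < n" using na \<open>c\<^sub>1 > 0\<close> by linarith
  moreover have "1 < a" using assms by (simp add: a_def)
  ultimately interpret prime_order_pair n "TYPE('a)" f g a
    by unfold_locales (use assms g_def in auto)
  have "c\<^sub>1 \<le> d * c\<^sub>1" using \<open>d > 0\<close> by simp
  then have c1: "c\<^sub>1 < a" unfolding a_def by linarith
  have fg: "{f, g} \<subseteq> G" "G \<subseteq> {0, f, g}" using G unfolding g_def a_def by auto
  \<comment> \<open>Weight \<open>n\<close> for 0 makes the atom \<open>{#0#}\<close> satisfy the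
    congruence.\<close>
  define w where "w x = (if x = 0 then n else if x = f then 1 else a)" for x
  have w_pair: "(\<Sum>x\<in>#pair_seq f g x y. w x) = x + y * a" for x y
    using f_nz g_nz f_neq_g by (simp add: pair_seq_def w_def)
  show ?thesis
  proof (rule min_Delta_eqI[where w = w and n = n])
    show "n > 0" using n_gt_1 by simp
  next
    fix U assume U: "minimal_zero_sum U" "set_mset U \<subseteq> G"
    show "int (d * n) dvd int (\<Sum>x\<in>#U. w x) - int n"
    proof (cases "0 \<in># U")
      case True
      then have "U = {#0#}" using minimal_zero_sum_subset[OF U(1), of "{#0#}"] by simp
      then show ?thesis by (simp add: w_def)
    next
      case False
      then have "set_mset U \<subseteq> {f, g}" using U fg by auto
      then obtain x y where Uxy: "U = pair_seq f g x y" using f_neq_g by (rule pair_seq_supportE)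
      have nz: "x > 0 \<or> y > 0" and dvd: "n dvd x + y * a"
        using U(1) unfolding Uxy minimal_zero_sum_def sum_pair_seq_eq_0_iff pair_seq_empty_iff
        by auto
      have min: "x' = x \<and> y' = y" if "x' \<le> x" "y' \<le> y" "x' > 0 \<or> y' > 0" "n dvd x' + y' * a" for x' y'
        using minimal_zero_sum_subset[OF U(1), of "pair_seq f g x' y'"] that
        unfolding Uxy pair_seq_subset_iff[OF f_neq_g] pair_seq_empty_iff sum_pair_seq_eq_0_iff
          pair_seq_eq_iff[OF f_neq_g] by auto
      obtain k where k: "x + y * a = n * (1 + k * d)"
      proof -
        \<comment> \<open>In the first three cases the atom contains, hence equals, a zero-sum
          sequence of known weight. The last two cases bound the multiplicities.\<close>
        consider "c\<^sub>1 \<le> x" "c\<^sub>2 \<le> y" | "n \<le> x" | "n \<le> y" | "y < c\<^sub>2" "x < n" | "x < c\<^sub>1" "y < n"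
          by linarith
        then show thesis
        proof cases
          case 1
          then have "c\<^sub>1 = x \<and> c\<^sub>2 = y" using min[of c\<^sub>1 c\<^sub>2] assms(5) na by (simp add: add.commute)
          then show thesis using that[of 0] na by simp
        next
          case 2
          then have "n = x \<and> 0 = y" using min[of n 0] n_gt_1 by auto
          then show thesis using that[of 0] by simp
        next
          case 3
          then have "0 = x \<and> n = y" using min[of 0 n] n_gt_1 by auto
          then show thesis using that[of c\<^sub>1] by (simp add: a_def)
        next
          case 4
          \<comment> \<open>The weight stays below \<open>2 * n\<close>, so it must be
            \<open>n\<close>.\<close>
          then have "y * a \<le> c\<^sub>2 * a" by simp
          then have less: "x + y * a < n * 2" using 4 na by linarith
          obtain i where i: "x + y * a = n * i" using dvd by (auto simp: dvd_def)
          have "i > 0" using i nz a_gt by (auto intro: gr0I)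
          moreover have "i < 2" using less unfolding i by simp
          ultimately have "i = 1" by simp
          then show thesis using that[of 0] i by simp
        next
          case 5
          define r where "r = c\<^sub>1 - x"
          \<comment> \<open>As \<open>(d * c\<^sub>2 + 1) * a = 1 + d * n\<close>, each of the
            \<open>r\<close> copies of \<open>f\<close> missing from \<open>c\<^sub>1\<close> can be
            replaced by \<open>d * c\<^sub>2 + 1\<close> copies of \<open>g\<close>, at the cost of
            \<open>d * n\<close> in weight. Invertibility of \<open>a\<close> modulo
            \<open>n\<close> then identifies \<open>y\<close> with \<open>z\<close>.\<close>
          define z where "z = (r * d + 1) * c\<^sub>2 + r"
          have c1r: "c\<^sub>1 = x + r" using 5 by (simp add: r_def)
          have z: "x + z * a = n * (1 + r * d)"
            unfolding z_def n a_def c1r by (simp add: algebra_simps)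
          have "z \<le> n" unfolding z_def n c1r by (simp add: algebra_simps)
          have "int n dvd int (x + y * a) - int (x + z * a)"
            by (intro dvd_diff) (use dvd z in \<open>simp_all only: int_dvd_int_iff dvd_triv_left\<close>)
          then have "int n dvd int a * (int y - int z)" by (simp add: algebra_simps)
          moreover have "\<not> int n dvd int a" using a_gt a_lt by (auto dest: dvd_imp_le)
          moreover have "prime (int n)" using prime by simp
          ultimately have yz: "int n dvd int y - int z" by (simp add: prime_dvd_mult_iff)
          have "y = z"
          proof (rule ccontr)
            assume "y \<noteq> z"
            then have "int n \<le> \<bar>int y - int z\<bar>" using yz dvd_imp_le_int[of "int y - int z" "int n"] by simp
            then have "y = 0" using \<open>y < n\<close> \<open>z \<le> n\<close> by linarith
            then have "n \<le> x" using dvd nz by (auto dest: dvd_imp_le)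
            then show False using 5 na by linarith
          qed
          then show thesis using that[of r] z by simp
        qed
      qed
      have "int (x + y * a) - int n = int (d * n) * int k"
        unfolding k by (simp add: algebra_simps)
      then show ?thesis unfolding Uxy w_pair by (metis dvd_triv_left)
    qed
  next
    \<comment> \<open>\<open>?U\<close> is the record atom for \<open>j = d + 1\<close>. Its product
      with \<open>?V\<close> regroups into \<open>d + 1\<close> copies of
      \<open>pair_seq f g c\<^sub>1 c\<^sub>2\<close> and one
      \<open>pair_seq f g (n - a) 1\<close>.\<close>
    let ?U = "pair_seq f g ((d + 1) * c\<^sub>1 - a) ((d + 1) * c\<^sub>2 + 1)"
    let ?V = "replicate_mset n f"
    have U: "minimal_zero_sum ?U"
      by (rule minimal_pair_seq_record[OF na c1]) (use assms in \<open>auto simp: a_def\<close>)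
    have V: "minimal_zero_sum ?V" using minimal_zero_sum_replicate f_nz by simp
    show "?U + ?V \<in> zero_sum_monoid G"
      by (intro zero_sum_monoid_add)
        (use U V set_pair_seq[of f g] fg n_gt_1 in \<open>auto simp: zero_sum_monoid_def minimal_zero_sum_def\<close>)
    show "1 + 1 \<in> lengths (?U + ?V)"
      by (intro lengths_add lengths_atom U V)
    have W: "minimal_zero_sum (pair_seq f g c\<^sub>1 c\<^sub>2)" "minimal_zero_sum (pair_seq f g (n - a) 1)"
      by (rule minimal_pair_seq_weight_n; use na a_lt in simp)+
    have "(d + 1) * 1 + 1 \<in> lengths (repeat_mset (d + 1) (pair_seq f g c\<^sub>1 c\<^sub>2) + pair_seq f g (n - a) 1)"
      by (intro lengths_add lengths_repeat lengths_atom W)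
    moreover have "repeat_mset (d + 1) (pair_seq f g c\<^sub>1 c\<^sub>2) + pair_seq f g (n - a) 1 = ?U + ?V"
    proof -
      have "a \<le> (d + 1) * c\<^sub>1" using \<open>c\<^sub>1 > 0\<close> by (simp add: a_def)
      then show ?thesis using f_neq_g a_lt
        by (intro multiset_eqI) (simp add: pair_seq_def)
    qed
    ultimately show "1 + 1 + d \<in> lengths (?U + ?V)" by (simp add: add.commute)
    show "d > 0" by fact
  qed
qed

section \<open>Arithmetic forced by a large minimal distance\<close>

context prime_order_pair
begin

lemma min_Delta_pair_relation:
  assumes G: "{f, g} \<subseteq> G" and d: "n \<le> (min_Delta G)\<^sup>2"
  obtains q r i where "q > 0" "r > 0" "i > 0" "n = r + q + min_Delta G * i * r * q"
    "a = 1 + min_Delta G * i * r"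
proof -
  define d where "d = min_Delta G"
  have len: "int d dvd int (x + y) - int n" if "minimal_zero_sum (pair_seq f g x y)" for x y
  proof -
    have "int (min_Delta G) dvd int (size (pair_seq f g x y)) - int n"
      by (rule min_Delta_dvd_atom[OF that])
        (use set_pair_seq[of f g x y] G f_nz g_nz in auto)
    then show ?thesis by (simp add: d_def pair_seq_def)
  qed
  have "int d dvd int (n - a + 1) - int n"
    by (rule len[OF minimal_pair_seq_weight_n]) (use a_lt in simp)
  then have "int d dvd - int (a - 1)" using a_lt a_gt by (simp add: of_nat_diff)
  then have da: "d dvd a - 1" by (metis dvd_minus_iff int_dvd_int_iff)
  then obtain k where "a - 1 = d * k" by (auto simp: dvd_def)
  then have k: "a = 1 + d * k" using a_gt by linarith
  have kd: "k > 0" "d > 0" using a_gt k by (auto intro: gr0I)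
  define q r where "q = n div a" and "r = n mod a"
  have n: "n = q * a + r" unfolding q_def r_def by simp
  have "r < a" unfolding r_def using a_gt by simp
  have "q > 0" unfolding q_def using a_gt a_lt by (simp add: div_greater_zero_iff)
  have "r > 0"
  proof (rule gr0I)
    assume "r = 0"
    then have "a dvd n" unfolding r_def by auto
    then show False using prime a_gt a_lt by (auto simp: prime_nat_iff)
  qed
  \<comment> \<open>The rounded-up quotient of \<open>a\<close> by \<open>r\<close>: the first
    \<open>j\<close> that yields a record atom.\<close>
  define j where "j = (LEAST j. a \<le> j * r)"
  have ja: "a \<le> j * r" unfolding j_def by (rule LeastI[of _ a]) (use \<open>r > 0\<close> in simp)
  then have j: "j > 0" using a_gt by (auto intro: gr0I)
  have ja': "(j - 1) * r < a"
    using not_less_Least[of "j - 1" "\<lambda>j. a \<le> j * r"] j unfolding j_def[symmetric] by simp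
  have "int d dvd int (j * r - a + (j * q + 1)) - int n"
    by (rule len[OF minimal_pair_seq_record[OF n \<open>r < a\<close> j ja' ja]])
  \<comment> \<open>Modulo \<open>d\<close> one has \<open>a = 1\<close> and
    \<open>n = q + r\<close>, so only \<open>n * (j - 1)\<close> survives.\<close>
  moreover have "int (j * r - a + (j * q + 1)) - int n = int n * (int j - 1) - int d * int (k * (j * q + 1))"
  proof -
    have "int (j * r - a) = int j * int r - int a" using ja by (simp add: of_nat_diff)
    moreover have "int n = int q * int a + int r" using arg_cong[OF n, of int] by simp
    moreover have "int a = 1 + int d * int k" using arg_cong[OF k, of int] by simp
    ultimately show ?thesis by (simp add: algebra_simps)
  qed
  ultimately have "int d dvd int n * (int j - 1)" by (simp add: dvd_diff_left_iff)
  then have "int d dvd int (n * (j - 1))" using j by (simp add: of_nat_diff)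
  then have "d dvd n * (j - 1)" by (simp only: int_dvd_int_iff)
  moreover have "coprime d n"
  proof -
    have "d \<le> a - 1" using da a_gt by (intro dvd_imp_le) auto
    then have "\<not> n dvd d" using a_lt kd by (auto dest!: dvd_imp_le)
    then show ?thesis using prime prime_imp_coprime coprime_commute by blast
  qed
  ultimately have "d dvd j - 1" by (simp add: coprime_dvd_mult_right_iff)
  then obtain i where "j - 1 = d * i" by (auto simp: dvd_def)
  then have i: "j = 1 + d * i" using j by linarith
  have "i > 0" using i ja \<open>r < a\<close> by (auto intro: gr0I)
  \<comment> \<open>With \<open>a - 1 = d * k\<close> and \<open>j - 1 = d * i\<close>, the bounds
    \<open>(j - 1) * r < a \<le> j * r\<close> trap \<open>d * k\<close> in an interval of length
    \<open>r\<close> starting at \<open>d * i * r\<close>.\<close>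
  have up: "d * (i * r) < 1 + d * k" using ja' i k by (simp add: mult_ac)
  have low: "d * k < r + d * (i * r)" using ja i k by (simp add: algebra_simps)
  have "d * (i * r) \<le> d * k" using up by linarith
  then have "i * r \<le> k" using kd by simp
  \<comment> \<open>Otherwise \<open>d < r \<le> i * r < k\<close>, whence
    \<open>d * d \<le> d * k < a < n\<close>, against \<open>n \<le> d\<^sup>2\<close>.\<close>
  have "\<not> i * r < k"
  proof
    assume "i * r < k"
    then have "d * (i * r + 1) \<le> d * k" by (intro mult_left_mono) auto
    then have "d < r" using low by simp
    moreover have "r \<le> i * r" using \<open>i > 0\<close> by simp
    ultimately have "d \<le> k" using \<open>i * r < k\<close> by linarith
    then have "d * d \<le> d * k" by simp
    then show False using d k a_lt unfolding d_def[symmetric] power2_eq_square by linarith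
  qed
  with \<open>i * r \<le> k\<close> have "k = i * r" by simp
  then have a: "a = 1 + d * i * r" using k by simp
  then have "n = r + q + d * i * r * q" using n by (simp add: algebra_simps)
  then show thesis using that \<open>q > 0\<close> \<open>r > 0\<close> \<open>i > 0\<close> a unfolding d_def by blast
qed

end

lemma (in prime_order_group) min_Delta_relation:
  assumes "{f, g} \<subseteq> G" "f \<noteq> g" "f \<noteq> 0" "g \<noteq> (0::'a)" "n \<le> (min_Delta G)\<^sup>2"
  obtains q r i where "q > 0" "r > 0" "i > 0" "n = r + q + min_Delta G * i * r * q"
    "g = nmult (1 + min_Delta G * i * r) f"
proof -
  obtain a where a: "a < n" "g = nmult a f" using obtain_nmult[OF \<open>f \<noteq> 0\<close>] .
  have "a \<noteq> 0" "a \<noteq> 1" using a assms by (auto intro: ccontr)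
  then interpret prime_order_pair n ty f g a
    by unfold_locales (use a assms in auto)
  show thesis
    by (rule min_Delta_pair_relation[OF assms(1,5)]) (use that a in blast)
qed

section \<open>Excluding a third nonzero element\<close>

lemma (in prime_order_group) no_three_elements:
  assumes "{f, g, h} \<subseteq> G" "f \<noteq> g" "f \<noteq> h" "g \<noteq> h" "0 \<notin> {f, g, h :: 'a}"
    and d: "2 * n ^ 2 \<le> min_Delta G ^ 3" "n \<le> (min_Delta G)\<^sup>2"
  shows False
proof -
  let ?d = "min_Delta G"
  have rel: "\<exists>q r. q > 0 \<and> r > 0 \<and> ?d * (q * r) < n \<and> nmult q v + nmult r u = 0"
    if uv: "{u, v} \<subseteq> G" "u \<noteq> v" "u \<noteq> 0" "v \<noteq> 0" for u v :: 'a
  proof -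
    obtain q r i where *: "q > 0" "r > 0" "i > 0" "n = r + q + ?d * i * r * q"
      "v = nmult (1 + ?d * i * r) u"
      using min_Delta_relation[OF uv d(2)] .
    have "?d * (q * r) * 1 \<le> ?d * (q * r) * i" using *(3) by (intro mult_left_mono) auto
    moreover have "n = r + q + ?d * (q * r) * i" using *(4) by (simp add: mult_ac)
    ultimately have "?d * (q * r) < n" using *(1) by linarith
    moreover have "nmult q v + nmult r u = nmult n u"
      unfolding *(5) nmult_nmult nmult_add[symmetric] by (subst *(4)) (simp add: algebra_simps)
    ultimately show ?thesis by (metis *(1,2) nmult_card)
  qed
  obtain q1 r1 where 1: "q1 > 0" "r1 > 0" "?d * (q1 * r1) < n" "nmult q1 g + nmult r1 f = 0"
    using rel[of f g] assms by auto
  obtain q2 r2 where 2: "q2 > 0" "r2 > 0" "?d * (q2 * r2) < n" "nmult q2 h + nmult r2 f = 0"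
    using rel[of f h] assms by auto
  obtain q3 r3 where 3: "q3 > 0" "r3 > 0" "?d * (q3 * r3) < n" "nmult q3 h + nmult r3 g = 0"
    using rel[of g h] assms by auto
  \<comment> \<open>The factors \<open>q1 * q3\<close>, \<open>q2 * r3\<close> and
    \<open>q1 * q2\<close> cancel \<open>h\<close> and \<open>g\<close>; both contributions to the
    coefficient of \<open>f\<close> are positive.\<close>
  define m where "m = q2 * r3 * r1 + q1 * q3 * r2"
  have "nmult (q1 * q3) (nmult q2 h + nmult r2 f) + nmult (q2 * r3) (nmult q1 g + nmult r1 f)
      = nmult (q1 * q2) (nmult q3 h + nmult r3 g) + nmult m f"
    unfolding nmult_add_right nmult_nmult m_def nmult_add by (simp add: algebra_simps)
  then have "nmult m f = 0" unfolding 1 2 3 by simp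
  then have "n dvd m" using nmult_eq_0_iff assms by auto
  moreover have "m > 0" unfolding m_def using 1 2 3 by simp
  ultimately have "n \<le> m" by (rule dvd_imp_le)
  \<comment> \<open>Each summand of \<open>m\<close> divides \<open>P\<close>, so
    \<open>m \<le> 2 * P\<close>, while multiplying the three bounds gives
    \<open>?d ^ 3 * P < n ^ 3\<close>.\<close>
  define P where "P = (q1 * r1) * (q2 * r2) * (q3 * r3)"
  have "q2 * r3 * r1 \<le> (q2 * r3 * r1) * (q1 * r2 * q3)" "q1 * q3 * r2 \<le> (q1 * q3 * r2) * (r1 * q2 * r3)"
    using 1 2 3 by simp_all
  moreover have "P = (q2 * r3 * r1) * (q1 * r2 * q3)" "P = (q1 * q3 * r2) * (r1 * q2 * r3)"
    unfolding P_def by (simp_all add: mult_ac)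
  ultimately have "m \<le> 2 * P" unfolding m_def by linarith
  have "(?d * (q1 * r1)) * (?d * (q2 * r2)) * (?d * (q3 * r3)) < n * n * n"
    by (intro mult_strict_mono 1 2 3) (use n_gt_1 in auto)
  then have "?d ^ 3 * P < n * n * n" unfolding P_def by (simp add: power3_eq_cube mult_ac)
  moreover have "2 * n ^ 2 * P \<le> ?d ^ 3 * P" using d by (intro mult_right_mono) auto
  moreover have "2 * n ^ 2 * P = n * n * (2 * P)" by (simp add: power2_eq_square)
  ultimately have "n * n * (2 * P) < n * n * n" by linarith
  then have "2 * P < n" by simp
  then show False using \<open>n \<le> m\<close> \<open>m \<le> 2 * P\<close> by simp
qed

text \<open>The only possible atoms are \<open>{#0#}\<close> and \<open>n\<close> copies of
  \<open>f\<close>. All weigh exactly \<open>n\<close>, so the congruence with modulus 0 makes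
  lengths unique.\<close>

lemma (in prime_order_group) Delta_singleton:
  assumes "G \<subseteq> {0, f :: 'a}"
  shows "Delta G = {}"
proof -
  define w where "w x = (if x = 0 then n else 1)" for x :: 'a
  have "int (0 * n) dvd int (\<Sum>x\<in>#U. w x) - int n"
    if U: "minimal_zero_sum U" "set_mset U \<subseteq> G" for U
  proof (cases "0 \<in># U")
    case True
    then have "U = {#0#}" using minimal_zero_sum_subset[OF U(1), of "{#0#}"] by simp
    then show ?thesis by (simp add: w_def)
  next
    case False
    then have "set_mset U \<subseteq> {f}" using U assms by auto
    then obtain k where k: "U = replicate_mset k f"
      using set_mset_subset_singletonD by metis
    then have "k > 0" "nmult k f = 0"
      using U(1) by (auto simp: minimal_zero_sum_def sum_mset_replicate intro: gr0I)
    moreover have "f \<noteq> 0" using False k \<open>k > 0\<close> by auto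
    ultimately have "n \<le> k" using nmult_eq_0_iff by (auto dest: dvd_imp_le)
    then have "replicate_mset n f \<subseteq># U" using k by (simp add: subseteq_mset_def)
    then have "U = replicate_mset n f"
      using minimal_zero_sum_subset[OF U(1)] n_gt_1 by (fastforce simp: sum_mset_replicate)
    then show ?thesis using \<open>f \<noteq> 0\<close> by (simp add: w_def)
  qed
  then have "int 0 dvd int l - int l'"
    if "C \<in> zero_sum_monoid G" "l \<in> lengths C" "l' \<in> lengths C" for C l l'
    using lengths_cong_weight[of n G 0 w C l l'] that n_gt_1 by simp
  then show ?thesis unfolding Delta_def distances_def by fastforce
qed

section \<open>Assembling the equivalence\<close>

theorem theorem7p6:
  fixes n d :: nat and G\<^sub>0 :: "'a::{ab_group_add,finite} set"
  assumes "prime n"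
    and "card (UNIV :: 'a set) = n"
    and "\<exists>g::'a. \<forall>x. \<exists>k. x = nmult k g"
    and "d \<in> Delta_star (UNIV :: 'a set)"
    and "real d \<ge> root 3 (2 * real n ^ 2)"
  shows "min_Delta G\<^sub>0 = d \<longleftrightarrow>
    (\<exists>(c\<^sub>1::nat) (c\<^sub>2::nat) (f::'a). c\<^sub>1 > 0 \<and> c\<^sub>2 > 0 \<and>
       real d = (real n - real c\<^sub>1 - real c\<^sub>2) / (real c\<^sub>1 * real c\<^sub>2) \<and> f \<noteq> 0 \<and>
       {f, nmult ((n - c\<^sub>1) div c\<^sub>2) f} \<subseteq> G\<^sub>0 \<and>
       G\<^sub>0 \<subseteq> {0, f, nmult ((n - c\<^sub>1) div c\<^sub>2) f})"
proof -
  interpret prime_order_group n "TYPE('a)"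
    by unfold_locales (use assms in auto)
  have "0 < root 3 (2 * real n ^ 2)" using n_gt_1 by simp
  then have d: "d > 0" using assms(5) by linarith
  have "root 3 (2 * real n ^ 2) ^ 3 \<le> real d ^ 3"
    by (intro power_mono assms) auto
  then have "real (2 * n ^ 2) \<le> real (d ^ 3)" by simp
  then have d3: "2 * n ^ 2 \<le> d ^ 3" by (simp only: of_nat_le_iff)
  \<comment> \<open>Otherwise \<open>d \<le> d\<^sup>2 < n\<close> gives
    \<open>d ^ 3 < n ^ 2\<close>, contradicting \<open>d3\<close>.\<close>
  have d2: "n \<le> d\<^sup>2"
  proof (rule ccontr)
    assume "\<not> n \<le> d\<^sup>2"
    then have "d\<^sup>2 < n" by simp
    then have "d ^ 2 * d < n * n"
      using self_le_power[of d 2] d by (intro mult_strict_mono) auto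
    then show False using d3 by (simp add: power2_eq_square power3_eq_cube)
  qed
  show ?thesis
  proof
    assume "min_Delta G\<^sub>0 = d"
    \<comment> \<open>Positivity of \<open>d\<close> rules out the default value 0, so two distinct
      nonzero elements exist.\<close>
    then have "Delta G\<^sub>0 \<noteq> {}" using d by (auto simp: min_Delta_def)
    then have *: "\<not> G\<^sub>0 \<subseteq> {0, f}" for f using Delta_singleton by blast
    from *[of 0] obtain f where f: "f \<in> G\<^sub>0" "f \<noteq> 0" by auto
    from *[of f] obtain g where g: "g \<in> G\<^sub>0" "g \<noteq> 0" "g \<noteq> f" by auto
    have sub: "G\<^sub>0 \<subseteq> {0, f, g}"
      using no_three_elements[of f g _ G\<^sub>0] f g d2 d3 \<open>min_Delta G\<^sub>0 = d\<close> by auto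
    obtain q r i where qr: "q > 0" "r > 0" "i > 0" "n = r + q + d * i * r * q"
      "g = nmult (1 + d * i * r) f"
      using min_Delta_relation[of f g G\<^sub>0] f g d2 \<open>min_Delta G\<^sub>0 = d\<close> by auto
    \<comment> \<open>The relation determines the minimal distance exactly, with
      \<open>d * i\<close> in the role of \<open>d\<close>; comparison forces
      \<open>i = 1\<close>.\<close>
    have "min_Delta G\<^sub>0 = d * i"
      by (rule min_Delta_pair[OF assms(1,2) f(2) _ qr(2,1,4)])
        (use qr d f g sub in auto)
    then have "i = 1" using \<open>min_Delta G\<^sub>0 = d\<close> d by simp
    then have n: "n = r + q + d * r * q" using qr by simp
    then have "n - r = (1 + d * r) * q" by (simp add: algebra_simps)
    then have g_eq: "g = nmult ((n - r) div q) f" using qr \<open>i = 1\<close> by simp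
    have "real d = (real n - real r - real q) / (real r * real q)"
      using qr(1,2) by (subst n) (simp add: field_simps)
    then show "\<exists>c\<^sub>1 c\<^sub>2 f. c\<^sub>1 > 0 \<and> c\<^sub>2 > 0 \<and>
       real d = (real n - real c\<^sub>1 - real c\<^sub>2) / (real c\<^sub>1 * real c\<^sub>2) \<and> f \<noteq> 0 \<and>
       {f, nmult ((n - c\<^sub>1) div c\<^sub>2) f} \<subseteq> G\<^sub>0 \<and>
       G\<^sub>0 \<subseteq> {0, f, nmult ((n - c\<^sub>1) div c\<^sub>2) f}"
      using qr(1,2) f g(1) sub g_eq by blast
  next
    assume "\<exists>c\<^sub>1 c\<^sub>2 f. c\<^sub>1 > 0 \<and> c\<^sub>2 > 0 \<and>
       real d = (real n - real c\<^sub>1 - real c\<^sub>2) / (real c\<^sub>1 * real c\<^sub>2) \<and> f \<noteq> 0 \<and>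
       {f, nmult ((n - c\<^sub>1) div c\<^sub>2) f} \<subseteq> G\<^sub>0 \<and>
       G\<^sub>0 \<subseteq> {0, f, nmult ((n - c\<^sub>1) div c\<^sub>2) f}"
    then obtain c1 c2 f where c: "c1 > 0" "c2 > 0" "f \<noteq> 0"
      and eq: "real d = (real n - real c1 - real c2) / (real c1 * real c2)"
      and G: "{f, nmult ((n - c1) div c2) f} \<subseteq> G\<^sub>0" "G\<^sub>0 \<subseteq> {0, f, nmult ((n - c1) div c2) f}"
      by blast
    have "real n = real (c1 + c2 + d * c1 * c2)"
      using eq c by (simp add: field_simps)
    then have n: "n = c1 + c2 + d * c1 * c2" by (simp only: of_nat_eq_iff)
    \<comment> \<open>The natural-number division is exact, with quotient
      \<open>1 + d * c1\<close>.\<close>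
    then have "n - c1 = (1 + d * c1) * c2" by (simp add: algebra_simps)
    then have "(n - c1) div c2 = 1 + d * c1" using c by simp
    then show "min_Delta G\<^sub>0 = d"
      using min_Delta_pair[OF assms(1,2) c(3) d c(1,2) n] G by simp
  qed
qed

end
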